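(* Let $Y=(y_1,\dots,y_n)'\in\mathbb{R}^n$, let $X$ be the $n\times p$ real matrix with rows $x_i'=(x_{i1},\dots,x_{ip})$, and let $\lambda>0$. The square-root lasso problem $$\text{(P)}\qquad \min_{\beta\in\mathbb{R}^p}\Big\{\frac1n\sum_{i=1}^n(y_i-x_i'\beta)^2\Big\}^{1/2}+\frac{\lambda}{n}\|\beta\|_1$$ is equivalent to the conic programming problem $$\text{(C)}\qquad \min_{t,v,\beta^+,\beta^-}\ \frac{t}{n^{1/2}}+\frac{\lambda}{n}\sum_{j=1}^p(\beta_j^++\beta_j^-)\ :\ \begin{array}{l} v_i=y_i-x_i'\beta^++x_i'\beta^-,\ i=1,\dots,n,\\ (v,t)\in Q^{n+1},\ \beta^+\in\mathbb{R}^p_+,\ \beta^-\in\mathbb{R}^p_+,\end{array}$$ and (C) admits the strongly dual problem $$\text{(D)}\qquad \max_{a\in\mathbb{R}^n}\ \frac1n\sum_{i=1}^n y_ia_i\ :\ \Big|\frac1n\sum_{i=1}^n x_{ij}a_i\Big|\le\frac{\lambda}{n},\ j=1,\dots,p,\quad \|a\|\le n^{1/2},$$ that is, the optimal values of (C) and (D) coincide. Moreover, if the solution $\hat\beta$ to (P) satisfies $Y\ne X\hat\beta$, then the (corresponding) solution $\hat\beta^+,\hat\beta^-,\hat v=(\hat v_1,\dots,\hat v_n)$ to (C) and the solution $\hat a$ to (D) are related via $$\hat\beta=\hat\beta^+-\hat\beta^-,\qquad \hat v_i=y_i-x_i'\hat\beta\ (i=1,\dots,n),\qquad \hat a=n^{1/2}\,\hat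 v/\|\hat v\|.$$
   Context: $\|\cdot\|$ is the Euclidean norm, $\|\beta\|_1=\sum_j|\beta_j|$, $\mathbb{R}^p_+$ is the nonnegative orthant, and $Q^{n+1}=\{(v,t)\in\mathbb{R}^n\times\mathbb{R}:t\ge\|v\|\}$ is the second-order (ice-cream) cone. "Equivalent" means that (P) and (C) have the same optimal value and that their solutions correspond through $\beta=\beta^+-\beta^-$ (the difference $\beta^+-\beta^-$ of any solution of (C) solves (P), and every solution of (P) arises this way). "Strongly dual" means that the dual problem has the same optimal value as the primal (no duality gap). *)

theory Defs
  imports "HOL-Analysis.Analysis"
begin

text \<open>
  The sample size and the number of regressors are the index types \<open>'n\<close> and \<open>'p\<close>;
  row \<open>i\<close> of the design matrix \<open>X\<close> is the vector written $x_i$ informally.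
  Optimal values are taken in \<^typ>\<open>ereal\<close>, so that they are meaningful without any
  feasibility or boundedness side condition. Optimal solutions are rendered by the library's
  \<^const>\<open>is_arg_min\<close> and \<^const>\<open>is_arg_max\<close>.
\<close>

definition l1_norm :: "real^'p \<Rightarrow> real" where
  "l1_norm \<beta> = (\<Sum>j\<in>UNIV. \<bar>\<beta> $ j\<bar>)"

definition ice_cream_cone :: "((real^'n) \<times> real) set" where
  "ice_cream_cone = {(v, t). t \<ge> norm v}"

definition nonneg_orthant :: "(real^'p) set" where
  "nonneg_orthant = {b. \<forall>j. 0 \<le> b $ j}"

definition sqrt_lasso_obj :: "real^'n \<Rightarrow> real^'p^'n \<Rightarrow> real \<Rightarrow> real^'p \<Rightarrow> real" where
  "sqrt_lasso_obj Y X l \<beta> =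
     sqrt (1 / real CARD('n) * (\<Sum>i\<in>UNIV. (Y $ i - row i X \<bullet> \<beta>)\<^sup>2))
     + l / real CARD('n) * l1_norm \<beta>"

text \<open>Points of the conic program are tuples \<open>(t, v, bp, bm)\<close>, with
  \<open>bp\<close> and \<open>bm\<close> standing for $\beta^+$ and $\beta^-$.\<close>

type_synonym ('n, 'p) conic_point = "real \<times> (real^'n) \<times> (real^'p) \<times> (real^'p)"

definition conic_domain :: "('n::finite, 'p::finite) conic_point set" where
  "conic_domain = {(t, v, bp, bm).
     (v, t) \<in> ice_cream_cone \<and> bp \<in> nonneg_orthant \<and> bm \<in> nonneg_orthant}"

definition conic_feasible :: "real^'n \<Rightarrow> real^'p^'n \<Rightarrow> ('n, 'p) conic_point set" where
  "conic_feasible Y X = {(t, v, bp, bm).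
     (t, v, bp, bm) \<in> conic_domain \<and>
     (\<forall>i. v $ i = Y $ i - row i X \<bullet> bp + row i X \<bullet> bm)}"

definition conic_obj :: "real \<Rightarrow> ('n::finite, 'p::finite) conic_point \<Rightarrow> real" where
  "conic_obj l = (\<lambda>(t, v, bp, bm).
     t / sqrt (real CARD('n)) + l / real CARD('n) * (\<Sum>j\<in>UNIV. bp $ j + bm $ j))"

definition dual_feasible :: "real^'p^'n \<Rightarrow> real \<Rightarrow> (real^'n) set" where
  "dual_feasible X l = {a.
     (\<forall>j. \<bar>1 / real CARD('n) * (\<Sum>i\<in>UNIV. X $ i $ j * a $ i)\<bar> \<le> l / real CARD('n)) \<and>
     norm a \<le> sqrt (real CARD('n))}"

definition dual_obj :: "real^'n \<Rightarrow> real^'n \<Rightarrow> real" where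
  "dual_obj Y a = 1 / real CARD('n) * (\<Sum>i\<in>UNIV. Y $ i * a $ i)"

text \<open>Lagrangian of the conic program, dualising the equality constraints.  The multiplier of
  the \<open>i\<close>-th constraint is \<open>a $ i / n\<close>, the scaling under which the objective of the dual
  becomes the average of the products \<open>Y $ i * a $ i\<close>.\<close>

definition conic_lagrangian ::
    "real^'n \<Rightarrow> real^'p^'n \<Rightarrow> real \<Rightarrow> ('n, 'p) conic_point \<Rightarrow> real^'n \<Rightarrow> real" where
  "conic_lagrangian Y X l = (\<lambda>(t, v, bp, bm) a.
     conic_obj l (t, v, bp, bm) +
     (\<Sum>i\<in>UNIV. a $ i / real CARD('n) * (Y $ i - row i X \<bullet> bp + row i X \<bullet> bm - v $ i)))"

definition conic_dual_function ::
    "real^'n \<Rightarrow> real^'p^'n \<Rightarrow> real \<Rightarrow> real^'n \<Rightarrow> ereal" where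
  "conic_dual_function Y X l a = (INF z\<in>conic_domain. ereal (conic_lagrangian Y X l z a))"

definition sqrt_lasso_value :: "real^'n \<Rightarrow> real^'p^'n \<Rightarrow> real \<Rightarrow> ereal" where
  "sqrt_lasso_value Y X l = (INF \<beta>. ereal (sqrt_lasso_obj Y X l \<beta>))"

definition conic_value :: "real^'n \<Rightarrow> real^'p^'n \<Rightarrow> real \<Rightarrow> ereal" where
  "conic_value Y X l = (INF z\<in>conic_feasible Y X. ereal (conic_obj l z))"

definition dual_value :: "real^'n \<Rightarrow> real^'p^'n \<Rightarrow> real \<Rightarrow> ereal" where
  "dual_value Y X l = (SUP a\<in>dual_feasible X l. ereal (dual_obj Y a))"

definition sqrt_lasso_solution :: "real^'n \<Rightarrow> real^'p^'n \<Rightarrow> real \<Rightarrow> real^'p \<Rightarrow> bool" where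
  "sqrt_lasso_solution Y X l \<beta> \<longleftrightarrow> is_arg_min (sqrt_lasso_obj Y X l) (\<lambda>_. True) \<beta>"

definition conic_solution ::
    "real^'n \<Rightarrow> real^'p^'n \<Rightarrow> real \<Rightarrow> ('n, 'p) conic_point \<Rightarrow> bool" where
  "conic_solution Y X l z \<longleftrightarrow> is_arg_min (conic_obj l) (\<lambda>z. z \<in> conic_feasible Y X) z"

definition dual_solution :: "real^'n \<Rightarrow> real^'p^'n \<Rightarrow> real \<Rightarrow> real^'n \<Rightarrow> bool" where
  "dual_solution Y X l a \<longleftrightarrow> is_arg_max (dual_obj Y) (\<lambda>a. a \<in> dual_feasible X l) a"

end

theory Submission
  imports Defs
begin

text \<open>
  The optimal value $V$ of the square-root lasso, as a function of $Y$, is a gauge: it is the infimum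
  of $\|w\|/\sqrt n + (\lambda/n)\|\gamma\|_1$ over all decompositions $Y = w + X\gamma$. Separating
  $Y$ from the convex set of points of gauge below $V$ produces a functional which, once
  normalised to take the value $V$ at $Y$, is a dual feasible point of value $V$; weak duality
  shows that it is optimal. Equality in the Cauchy-Schwarz step of weak duality
  forces the relation between $\hat a$ and a nonzero residual $\hat v$.
\<close>

section \<open>Arithmetic of the l1 norm and matrix forms of the objectives\<close>

lemma divide_sqrt_eq: "x / sqrt y = x * sqrt y / y" if "0 < y"
  using that by (simp add: field_simps)

lemma row_inner: "row i X \<bullet> \<beta> = (X *v \<beta>) $ i"
  for X :: "real^'p^'n"
  by (simp add: matrix_vector_mul_component row_def)

lemma l1_norm_nonneg: "0 \<le> l1_norm \<beta>"
  by (simp add: l1_norm_def sum_nonneg)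

lemma l1_norm_0: "l1_norm 0 = 0"
  by (simp add: l1_norm_def)

lemma l1_norm_axis: "l1_norm (axis j c) = \<bar>c\<bar>"
proof -
  have "l1_norm (axis j c) = (\<Sum>k\<in>UNIV. if k = j then \<bar>c\<bar> else 0)"
    unfolding l1_norm_def by (intro sum.cong) (auto simp: axis_def)
  then show ?thesis by simp
qed

lemma l1_norm_scaleR: "l1_norm (c *\<^sub>R \<beta>) = \<bar>c\<bar> * l1_norm \<beta>"
  by (simp add: l1_norm_def abs_mult sum_distrib_left)

lemma l1_norm_triangle: "l1_norm (\<beta> + \<gamma>) \<le> l1_norm \<beta> + l1_norm \<gamma>"
  unfolding l1_norm_def sum.distrib[symmetric] by (intro sum_mono) simp

lemma norm_le_l1_norm: "norm \<beta> \<le> l1_norm \<beta>"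
  unfolding l1_norm_def by (rule norm_le_l1_cart)

lemma continuous_on_l1_norm: "continuous_on S l1_norm"
  unfolding l1_norm_def[abs_def] by (intro continuous_intros)

lemma sqrt_lasso_obj_eq:
  "sqrt_lasso_obj Y X l \<beta> = norm (Y - X *v \<beta>) / sqrt (real CARD('n)) + l / real CARD('n) * l1_norm \<beta>"
  for Y :: "real^'n"
  unfolding sqrt_lasso_obj_def norm_vec_def L2_set_def
  by (simp add: row_inner real_sqrt_divide)

lemma dual_obj_eq: "dual_obj Y a = (Y \<bullet> a) / real CARD('n)"
  for Y :: "real^'n"
  by (simp add: dual_obj_def inner_vec_def)

lemma inner_matrix_vector_mult:
  "a \<bullet> (X *v \<gamma>) = (\<Sum>j\<in>UNIV. (\<Sum>i\<in>UNIV. X $ i $ j * a $ i) * \<gamma> $ j)"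
  for X :: "real^'p^'n"
proof -
  have "a \<bullet> (X *v \<gamma>) = (\<Sum>i\<in>UNIV. \<Sum>j\<in>UNIV. X $ i $ j * a $ i * \<gamma> $ j)"
    by (simp add: inner_vec_def matrix_vector_mult_def sum_distrib_left mult_ac)
  also have "\<dots> = (\<Sum>j\<in>UNIV. \<Sum>i\<in>UNIV. X $ i $ j * a $ i * \<gamma> $ j)"
    by (rule sum.swap)
  finally show ?thesis by (simp add: sum_distrib_right)
qed

lemma inner_matrix_vector_mult_axis:
  "a \<bullet> (X *v axis j c) = (\<Sum>i\<in>UNIV. X $ i $ j * a $ i) * c"
  for X :: "real^'p^'n"
proof -
  have "a \<bullet> (X *v axis j c) = (\<Sum>k\<in>UNIV. if k = j then (\<Sum>i\<in>UNIV. X $ i $ j * a $ i) * c else 0)"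
    unfolding inner_matrix_vector_mult by (intro sum.cong) (auto simp: axis_def)
  then show ?thesis by simp
qed

section \<open>Dual feasibility\<close>

lemma dual_feasible_iff_columns:
  "a \<in> dual_feasible X l \<longleftrightarrow>
    (\<forall>j. \<bar>\<Sum>i\<in>UNIV. X $ i $ j * a $ i\<bar> \<le> l) \<and> norm a \<le> sqrt (real CARD('n))"
  for X :: "real^'p^'n"
  by (simp add: dual_feasible_def abs_mult divide_le_cancel)

text \<open>This is duality of the l1 and sup norms: a column bound extends to every
  \<open>\<gamma>\<close> coordinate by coordinate, and testing with the two signed unit vectors
  recovers it. The form on the right is the one a separating functional delivers.\<close>

lemma dual_feasible_iff:
  "a \<in> dual_feasible X l \<longleftrightarrow>
    (\<forall>\<gamma>. a \<bullet> (X *v \<gamma>) \<le> l * l1_norm \<gamma>) \<and> norm a \<le> sqrt (real CARD('n))"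
  for X :: "real^'p^'n"
proof -
  have "a \<bullet> (X *v \<gamma>) \<le> l * l1_norm \<gamma>"
    if "\<forall>j. \<bar>\<Sum>i\<in>UNIV. X $ i $ j * a $ i\<bar> \<le> l" for \<gamma>
  proof -
    have "(\<Sum>i\<in>UNIV. X $ i $ j * a $ i) * \<gamma> $ j \<le> l * \<bar>\<gamma> $ j\<bar>" for j
    proof -
      have "(\<Sum>i\<in>UNIV. X $ i $ j * a $ i) * \<gamma> $ j \<le> \<bar>\<Sum>i\<in>UNIV. X $ i $ j * a $ i\<bar> * \<bar>\<gamma> $ j\<bar>"
        unfolding abs_mult[symmetric] by (rule abs_ge_self)
      also have "\<dots> \<le> l * \<bar>\<gamma> $ j\<bar>"
        using that by (intro mult_right_mono) auto
      finally show ?thesis .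
    qed
    then show ?thesis
      unfolding inner_matrix_vector_mult l1_norm_def sum_distrib_left by (intro sum_mono)
  qed
  moreover have "\<bar>\<Sum>i\<in>UNIV. X $ i $ j * a $ i\<bar> \<le> l"
    if "\<forall>\<gamma>. a \<bullet> (X *v \<gamma>) \<le> l * l1_norm \<gamma>" for j
    using that[rule_format, of "axis j 1"] that[rule_format, of "axis j (-1)"]
    by (simp add: inner_matrix_vector_mult_axis l1_norm_axis)
  ultimately show ?thesis
    unfolding dual_feasible_iff_columns by blast
qed

section \<open>Equivalence of the square-root lasso and the conic program\<close>

lemma conic_feasible_iff:
  "(t, v, bp, bm) \<in> conic_feasible Y X \<longleftrightarrow>
    norm v \<le> t \<and> (\<forall>j. 0 \<le> bp $ j) \<and> (\<forall>j. 0 \<le> bm $ j) \<and> v = Y - X *v (bp - bm)"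
  by (auto simp: conic_feasible_def conic_domain_def ice_cream_cone_def nonneg_orthant_def
      row_inner vec_eq_iff matrix_vector_mult_diff_distrib)

text \<open>The epigraph variable \<open>t\<close> dominates the norm of the residual, and
  nonnegative numbers satisfy |p - m| \<le> p + m, so both terms can only shrink.\<close>

lemma sqrt_lasso_obj_le_conic_obj:
  assumes "0 \<le> l" "(t, v, bp, bm) \<in> conic_feasible Y X"
  shows "sqrt_lasso_obj Y X l (bp - bm) \<le> conic_obj l (t, v, bp, bm)"
proof -
  have "\<bar>bp $ j - bm $ j\<bar> \<le> bp $ j + bm $ j" for j
  proof -
    have "0 \<le> bp $ j" "0 \<le> bm $ j"
      using assms(2) by (auto simp: conic_feasible_iff)
    then show ?thesis by linarith
  qed
  then have "l1_norm (bp - bm) \<le> (\<Sum>j\<in>UNIV. bp $ j + bm $ j)"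
    unfolding l1_norm_def by (intro sum_mono) simp
  then show ?thesis
    using assms unfolding sqrt_lasso_obj_eq conic_obj_def prod.case
    by (intro add_mono mult_left_mono divide_right_mono) (auto simp: conic_feasible_iff)
qed

text \<open>The parts of \<open>\<beta>\<close> attain equality in the preceding bound.\<close>

definition conic_lift :: "real^'n \<Rightarrow> real^'p^'n \<Rightarrow> real^'p \<Rightarrow> ('n::finite, 'p::finite) conic_point" where
  "conic_lift Y X \<beta> =
    (norm (Y - X *v \<beta>), Y - X *v \<beta>, (\<chi> j. max (\<beta> $ j) 0), (\<chi> j. max (- \<beta> $ j) 0))"

lemma diff_pos_neg_part: "(\<chi> j. max (\<beta> $ j) 0) - (\<chi> j. max (- \<beta> $ j) 0) = \<beta>"
  for \<beta> :: "real^'p"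
  by (auto simp: vec_eq_iff max_def)

lemma conic_lift_feasible: "conic_lift Y X \<beta> \<in> conic_feasible Y X"
  by (simp add: conic_lift_def conic_feasible_iff diff_pos_neg_part)

lemma conic_obj_conic_lift: "conic_obj l (conic_lift Y X \<beta>) = sqrt_lasso_obj Y X l \<beta>"
proof -
  have "(\<Sum>j\<in>UNIV. max (\<beta> $ j) 0 + max (- \<beta> $ j) 0) = l1_norm \<beta>"
    unfolding l1_norm_def by (intro sum.cong) auto
  then show ?thesis
    by (simp add: conic_lift_def conic_obj_def sqrt_lasso_obj_eq)
qed

lemma sqrt_lasso_value_eq_conic_value:
  assumes "0 \<le> l"
  shows "sqrt_lasso_value Y X l = conic_value Y X l"
proof (rule antisym)
  show "sqrt_lasso_value Y X l \<le> conic_value Y X l"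
    unfolding sqrt_lasso_value_def conic_value_def
  proof (rule INF_greatest)
    fix z assume z: "z \<in> conic_feasible Y X"
    obtain t v bp bm where "z = (t, v, bp, bm)" by (cases z) auto
    then show "(INF \<beta>. ereal (sqrt_lasso_obj Y X l \<beta>)) \<le> ereal (conic_obj l z)"
      using sqrt_lasso_obj_le_conic_obj[OF assms] z by (intro INF_lower2[of "bp - bm"]) auto
  qed
  show "conic_value Y X l \<le> sqrt_lasso_value Y X l"
    unfolding sqrt_lasso_value_def conic_value_def
    by (rule INF_mono) (metis conic_lift_feasible conic_obj_conic_lift order_refl)
qed

lemma conic_solution_conic_lift:
  assumes "0 \<le> l" "sqrt_lasso_solution Y X l \<beta>"
  shows "conic_solution Y X l (conic_lift Y X \<beta>)"
  unfolding conic_solution_def is_arg_min_linorder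
proof (intro conjI allI impI)
  fix z assume z: "z \<in> conic_feasible Y X"
  obtain t v bp bm where [simp]: "z = (t, v, bp, bm)" by (cases z) auto
  have "sqrt_lasso_obj Y X l \<beta> \<le> sqrt_lasso_obj Y X l (bp - bm)"
    using assms(2) by (simp add: sqrt_lasso_solution_def is_arg_min_linorder)
  also have "\<dots> \<le> conic_obj l z"
    using sqrt_lasso_obj_le_conic_obj[OF assms(1)] z by simp
  finally show "conic_obj l (conic_lift Y X \<beta>) \<le> conic_obj l z"
    by (simp add: conic_obj_conic_lift)
qed (rule conic_lift_feasible)

text \<open>Any competitor \<open>\<beta>\<close> enters the conic program through its lift at the
  same cost, and passing from a conic point to the difference of its parts never raises the
  cost.\<close>

lemma sqrt_lasso_solution_diff:
  assumes "0 \<le> l" and sol: "conic_solution Y X l (t, v, bp, bm)"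
  shows "sqrt_lasso_solution Y X l (bp - bm)"
  unfolding sqrt_lasso_solution_def is_arg_min_linorder
proof (intro conjI allI impI TrueI)
  fix \<beta>
  have "sqrt_lasso_obj Y X l (bp - bm) \<le> conic_obj l (t, v, bp, bm)"
    using sol by (intro sqrt_lasso_obj_le_conic_obj assms) (simp add: conic_solution_def is_arg_min_def)
  also have "\<dots> \<le> conic_obj l (conic_lift Y X \<beta>)"
    using sol conic_lift_feasible[of Y X \<beta>] unfolding conic_solution_def is_arg_min_linorder by blast
  finally show "sqrt_lasso_obj Y X l (bp - bm) \<le> sqrt_lasso_obj Y X l \<beta>"
    by (simp add: conic_obj_conic_lift)
qed

section \<open>Existence of a lasso solution\<close>

text \<open>Since \<open>l > 0\<close>, the penalty alone bounds the sublevel set at the level of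
  the zero vector; that set is compact, and the continuous objective attains its minimum
  there.\<close>

lemma sqrt_lasso_solution_exists:
  fixes Y :: "real^'n"
  assumes "l > 0"
  shows "\<exists>\<beta>. sqrt_lasso_solution Y X l \<beta>"
proof -
  let ?f = "sqrt_lasso_obj Y X l" and ?n = "real CARD('n)"
  define S where "S = {\<beta>. ?f \<beta> \<le> ?f 0}"
  have cont: "continuous_on A ?f" for A
    unfolding sqrt_lasso_obj_eq[abs_def]
    by (intro continuous_intros continuous_on_l1_norm matrix_vector_mult_linear_continuous_on) auto
  have "norm \<beta> \<le> ?f 0 * ?n / l" if "\<beta> \<in> S" for \<beta>
  proof -
    have "l / ?n * l1_norm \<beta> \<le> ?f \<beta>"
      unfolding sqrt_lasso_obj_eq by simp
    also have "\<dots> \<le> ?f 0" using that by (simp add: S_def)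
    finally have "l1_norm \<beta> \<le> ?f 0 * ?n / l"
      using assms by (simp add: field_simps)
    then show ?thesis using norm_le_l1_norm[of \<beta>] by simp
  qed
  then have "bounded S" unfolding bounded_iff by blast
  moreover have "closed S"
    unfolding S_def by (intro closed_Collect_le cont continuous_on_const)
  moreover have "0 \<in> S" by (simp add: S_def)
  ultimately obtain \<beta> where \<beta>: "\<beta> \<in> S" "\<And>\<gamma>. \<gamma> \<in> S \<Longrightarrow> ?f \<beta> \<le> ?f \<gamma>"
    using continuous_attains_inf[of S ?f] cont by (auto simp: compact_eq_bounded_closed)
  have "?f \<beta> \<le> ?f 0" using \<beta>(1) by (simp add: S_def)
  \<comment> \<open>Outside \<open>S\<close> the objective exceeds its value at 0, so the minimiser
    over \<open>S\<close> is global.\<close>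
  then have "?f \<beta> \<le> ?f \<gamma>" for \<gamma>
    using \<beta>(2)[of \<gamma>] by (cases "\<gamma> \<in> S") (auto simp: S_def)
  then show ?thesis
    by (auto simp: sqrt_lasso_solution_def is_arg_min_linorder)
qed

section \<open>Weak and strong duality\<close>

lemma zero_dual_feasible: "0 \<le> l \<Longrightarrow> 0 \<in> dual_feasible X l"
  by (simp add: dual_feasible_iff l1_norm_nonneg)

text \<open>The second bound is finer: its left side is the Cauchy-Schwarz defect of the residual
  against \<open>a\<close>, nonnegative because \<open>norm a\<close> is at most the root of the
  sample size. A vanishing duality gap therefore forces this defect to vanish too.\<close>

lemma weak_duality:
  fixes Y :: "real^'n"
  assumes "a \<in> dual_feasible X l"
  shows "dual_obj Y a \<le> sqrt_lasso_obj Y X l \<beta>"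
    and "norm (Y - X *v \<beta>) / sqrt (real CARD('n)) - (Y - X *v \<beta>) \<bullet> a / real CARD('n)
      \<le> sqrt_lasso_obj Y X l \<beta> - dual_obj Y a"
proof -
  let ?n = "real CARD('n)" and ?r = "Y - X *v \<beta>"
  have split: "Y \<bullet> a = ?r \<bullet> a + a \<bullet> (X *v \<beta>)"
    by (simp add: inner_diff_left inner_diff_right inner_commute)
  have "a \<bullet> (X *v \<beta>) / ?n \<le> l / ?n * l1_norm \<beta>"
    using assms by (simp add: dual_feasible_iff divide_right_mono)
  then show 2: "norm ?r / sqrt ?n - ?r \<bullet> a / ?n \<le> sqrt_lasso_obj Y X l \<beta> - dual_obj Y a"
    unfolding sqrt_lasso_obj_eq dual_obj_eq split add_divide_distrib by simp
  have "?r \<bullet> a \<le> norm ?r * norm a" by (rule norm_cauchy_schwarz)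
  also have "\<dots> \<le> norm ?r * sqrt ?n"
    using assms by (intro mult_left_mono) (auto simp: dual_feasible_iff)
  finally have "?r \<bullet> a / ?n \<le> norm ?r / sqrt ?n"
    by (simp add: divide_sqrt_eq divide_right_mono)
  with 2 show "dual_obj Y a \<le> sqrt_lasso_obj Y X l \<beta>" by simp
qed

lemma strong_duality:
  fixes Y :: "real^'n" and X :: "real^'p^'n"
  assumes "l > 0" and sol: "sqrt_lasso_solution Y X l \<beta>"
  shows "\<exists>a\<in>dual_feasible X l. dual_obj Y a = sqrt_lasso_obj Y X l \<beta>"
proof (cases "sqrt_lasso_obj Y X l \<beta> = 0")
  case True
  \<comment> \<open>At optimal value zero the multiplier 0 suffices. The separation below needs a
    positive value, so that 0 has gauge below it.\<close>
  then show ?thesis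
    using assms by (intro bexI[of _ 0]) (auto simp: dual_obj_eq zero_dual_feasible)
next
  case False
  define n where "n = real CARD('n)"
  define V where "V = sqrt_lasso_obj Y X l \<beta>"
  have n: "n > 0" by (simp add: n_def)
  have "V \<ge> 0"
    using assms(1) by (simp add: V_def sqrt_lasso_obj_eq l1_norm_nonneg)
  with False have V: "V > 0" by (simp add: V_def)
  \<comment> \<open>The cost of a decomposition \<open>Y = w + X *v \<gamma>\<close>; the lasso
    objective at \<open>\<gamma>\<close> is \<open>g (Y - X *v \<gamma>, \<gamma>)\<close>.
    Homogeneity and subadditivity of \<open>g\<close> make its sublevel sets convex.\<close>
  define g where "g = (\<lambda>(w :: real^'n, \<gamma> :: real^'p). norm w / sqrt n + l / n * l1_norm \<gamma>)"
  have g_scale: "g (c *\<^sub>R z) = \<bar>c\<bar> * g z" for c z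
    by (cases z) (simp add: g_def l1_norm_scaleR algebra_simps)
  have g_add: "g (z + z') \<le> g z + g z'" for z z'
  proof (cases z; cases z')
    fix w \<gamma> w' \<gamma>' assume z: "z = (w, \<gamma>)" "z' = (w', \<gamma>')"
    have "norm (w + w') / sqrt n \<le> (norm w + norm w') / sqrt n"
      using n by (intro divide_right_mono norm_triangle_ineq) auto
    moreover have "l / n * l1_norm (\<gamma> + \<gamma>') \<le> l / n * (l1_norm \<gamma> + l1_norm \<gamma>')"
      using n assms(1) by (intro mult_left_mono l1_norm_triangle) auto
    ultimately show ?thesis
      by (simp add: z g_def add_divide_distrib distrib_left)
  qed
  define A where "A = (\<lambda>(w, \<gamma> :: real^'p). w + X *v \<gamma>)"
  have "linear A"
    by (rule linearI) (auto simp: A_def algebra_simps matrix_vector_right_distrib matrix_vector_mult_scaleR)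
  define K where "K = {z. g z < V}"
  have "convex K"
    unfolding convex_def
  proof (intro ballI allI impI)
    fix x y and u v :: real
    assume H: "x \<in> K" "y \<in> K" "0 \<le> u" "0 \<le> v" "u + v = 1"
    have "g (u *\<^sub>R x + v *\<^sub>R y) \<le> u * g x + v * g y"
      using g_add[of "u *\<^sub>R x" "v *\<^sub>R y"] H by (simp add: g_scale)
    also have "\<dots> < V"
      using H convex_bound_lt[of "g x" V "g y" u v] by (simp add: K_def)
    finally show "u *\<^sub>R x + v *\<^sub>R y \<in> K" by (simp add: K_def)
  qed
  then have "convex (A ` K)" using \<open>linear A\<close> by (rule convex_linear_image[rotated])
  have "0 \<in> K" using V by (simp add: K_def g_def zero_prod_def l1_norm_0)
  \<comment> \<open>A decomposition of \<open>Y\<close> in \<open>K\<close> would give a coefficient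
    vector beating the minimum \<open>V\<close>.\<close>
  have "Y \<notin> A ` K"
  proof
    assume "Y \<in> A ` K"
    then obtain w \<gamma> where *: "Y = w + X *v \<gamma>" "g (w, \<gamma>) < V" by (auto simp: A_def K_def)
    have "V \<le> sqrt_lasso_obj Y X l \<gamma>"
      using sol by (simp add: V_def sqrt_lasso_solution_def is_arg_min_linorder)
    with * show False by (simp add: sqrt_lasso_obj_eq g_def n_def)
  qed
  then have "A ` K \<inter> {Y} = {}" by simp
  moreover have "A ` K \<noteq> {}" using \<open>0 \<in> K\<close> by blast
  ultimately obtain b c where b: "b \<noteq> 0" and K: "\<And>x. x \<in> A ` K \<Longrightarrow> b \<bullet> x \<le> c" and c: "c \<le> b \<bullet> Y"
    using separating_hyperplane_sets[OF \<open>convex (A ` K)\<close> convex_singleton[of Y]] by force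
  \<comment> \<open>Rescaling \<open>z\<close> to cost \<open>\<theta> * V\<close> puts it in
    \<open>K\<close>, where the separation applies; letting \<open>\<theta>\<close> tend to 1 gives
    a homogeneous inequality.\<close>
  have sep: "V * (b \<bullet> A z) \<le> (b \<bullet> Y) * g z" if "g z > 0" for z
  proof (rule field_le_mult_one_interval)
    fix \<theta> :: real assume \<theta>: "0 < \<theta>" "\<theta> < 1"
    have "(\<theta> * V / g z) *\<^sub>R z \<in> K"
      using \<theta> that V by (simp add: K_def g_scale)
    then have "b \<bullet> A ((\<theta> * V / g z) *\<^sub>R z) \<le> b \<bullet> Y"
      using K c by fastforce
    then show "\<theta> * (V * (b \<bullet> A z)) \<le> (b \<bullet> Y) * g z"
      using that by (simp add: linear_scale[OF \<open>linear A\<close>] field_simps)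
  qed
  \<comment> \<open>Pairs with one zero component split the inequality into the future norm bound
    and the future column bounds. Zero vectors have zero cost and are treated apart.\<close>
  have w: "V * (b \<bullet> w) \<le> (b \<bullet> Y) * (norm w / sqrt n)" for w
    using sep[of "(w, 0)"] n by (cases "w = 0") (auto simp: g_def A_def l1_norm_0)
  have \<gamma>: "V * (b \<bullet> (X *v \<gamma>)) \<le> (b \<bullet> Y) * (l / n * l1_norm \<gamma>)" for \<gamma>
  proof (cases "\<gamma> = 0")
    case False
    then have "l1_norm \<gamma> > 0" using norm_le_l1_norm[of \<gamma>] by (smt (verit) zero_less_norm_iff)
    then show ?thesis using sep[of "(0, \<gamma>)"] n assms(1) by (auto simp: g_def A_def)
  qed (simp add: l1_norm_0)
  \<comment> \<open>Testing with \<open>w = b\<close> shows that the separating functional is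
    positive at \<open>Y\<close>, which permits the normalisation below.\<close>
  have "0 < V * (b \<bullet> b)" using V b by simp
  then have "0 < (b \<bullet> Y) * (norm b / sqrt n)" using w[of b] by linarith
  then have bY: "b \<bullet> Y > 0"
    using n by (simp add: zero_less_mult_iff zero_less_divide_iff)
  \<comment> \<open>The factor is chosen to make \<open>dual_obj Y a\<close> equal to
    \<open>V\<close>.\<close>
  define a where "a = (n * V / (b \<bullet> Y)) *\<^sub>R b"
  have "a \<bullet> (X *v \<gamma>) \<le> l * l1_norm \<gamma>" for \<gamma>
    using \<gamma>[of \<gamma>] n bY by (simp add: a_def field_simps)
  moreover have "norm a \<le> sqrt n"
  proof -
    \<comment> \<open>Again \<open>w = b\<close>, with one factor \<open>norm b\<close>
      cancelled.\<close>
    have "V * norm b \<le> (b \<bullet> Y) / sqrt n"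
    proof (rule mult_left_le_imp_le)
      show "norm b * (V * norm b) \<le> norm b * ((b \<bullet> Y) / sqrt n)"
        using w[of b] by (simp add: dot_square_norm power2_eq_square mult_ac)
    qed (use b in simp)
    then have "norm a \<le> n / sqrt n"
      using n bY V by (simp add: a_def field_simps)
    then show ?thesis using n by (simp add: real_div_sqrt)
  qed
  ultimately have "a \<in> dual_feasible X l" by (simp add: dual_feasible_iff n_def)
  moreover have "dual_obj Y a = V"
    using n bY by (simp add: dual_obj_eq a_def n_def[symmetric] inner_commute)
  ultimately show ?thesis by (auto simp: V_def)
qed

lemma dual_solution_exists:
  assumes "l > 0"
  shows "\<exists>a. dual_solution Y X l a"
proof -
  obtain \<beta> where "sqrt_lasso_solution Y X l \<beta>"
    using sqrt_lasso_solution_exists[OF assms] by blast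
  then obtain a where "a \<in> dual_feasible X l" "dual_obj Y a = sqrt_lasso_obj Y X l \<beta>"
    using strong_duality[OF assms] by blast
  then show ?thesis
    using weak_duality(1) unfolding dual_solution_def is_arg_max_linorder by fastforce
qed

lemma dual_solution_obj:
  assumes "l > 0" "sqrt_lasso_solution Y X l \<beta>" "dual_solution Y X l a"
  shows "dual_obj Y a = sqrt_lasso_obj Y X l \<beta>"
proof (rule antisym)
  show "dual_obj Y a \<le> sqrt_lasso_obj Y X l \<beta>"
    using assms(3) by (intro weak_duality) (simp add: dual_solution_def is_arg_max_def)
  show "sqrt_lasso_obj Y X l \<beta> \<le> dual_obj Y a"
    using strong_duality[OF assms(1,2)] assms(3) by (auto simp: dual_solution_def is_arg_max_linorder)
qed

lemma sqrt_lasso_value_eq_dual_value: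
  assumes "l > 0"
  shows "sqrt_lasso_value Y X l = dual_value Y X l"
proof (rule antisym)
  obtain \<beta> where \<beta>: "sqrt_lasso_solution Y X l \<beta>"
    using sqrt_lasso_solution_exists[OF assms] by blast
  obtain a where a: "a \<in> dual_feasible X l" "dual_obj Y a = sqrt_lasso_obj Y X l \<beta>"
    using strong_duality[OF assms \<beta>] by blast
  have "sqrt_lasso_value Y X l \<le> ereal (sqrt_lasso_obj Y X l \<beta>)"
    unfolding sqrt_lasso_value_def by (rule INF_lower) simp
  also have "\<dots> \<le> dual_value Y X l"
    unfolding dual_value_def a(2)[symmetric] by (rule SUP_upper[OF a(1)])
  finally show "sqrt_lasso_value Y X l \<le> dual_value Y X l" .
  show "dual_value Y X l \<le> sqrt_lasso_value Y X l"
    unfolding sqrt_lasso_value_def dual_value_def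
    by (intro SUP_least INF_greatest) (simp add: weak_duality)
qed

section \<open>The dual solution as a rescaled residual\<close>

text \<open>With no duality gap, \<open>a\<close> has component at least \<open>s\<close> along the
  residual, while \<open>norm a \<le> s\<close>. Expanding the square then shows that its distance
  to the residual rescaled to length \<open>s\<close> is zero.\<close>

lemma dual_solution_eq:
  fixes Y :: "real^'n"
  assumes "l > 0" "sqrt_lasso_solution Y X l \<beta>" "dual_solution Y X l a" "Y \<noteq> X *v \<beta>"
  shows "a = (sqrt (real CARD('n)) / norm (Y - X *v \<beta>)) *\<^sub>R (Y - X *v \<beta>)"
proof -
  define r where "r = Y - X *v \<beta>"
  define s where "s = sqrt (real CARD('n))"
  have s: "s > 0" "real CARD('n) = s\<^sup>2" by (simp_all add: s_def)
  have r: "norm r > 0" using assms(4) by (simp add: r_def)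
  have feas: "a \<in> dual_feasible X l"
    using assms(3) by (simp add: dual_solution_def is_arg_max_def)
  then have "norm a \<le> s" by (simp add: dual_feasible_iff s_def)
  then have "(norm a)\<^sup>2 \<le> s\<^sup>2" by (intro power_mono) auto
  \<comment> \<open>The gap bounding the Cauchy-Schwarz defect is zero at optimal solutions.\<close>
  have "norm r / s \<le> r \<bullet> a / s\<^sup>2"
    using weak_duality(2)[OF feas, of Y \<beta>] dual_solution_obj[OF assms(1-3)]
    unfolding r_def[symmetric] s_def[symmetric] unfolding s(2) by simp
  then have "s \<le> r \<bullet> a / norm r"
    using s r by (simp add: field_simps power2_eq_square)
  then have "s\<^sup>2 \<le> s * (r \<bullet> a / norm r)"
    unfolding power2_eq_square using s(1) by (intro mult_left_mono) auto
  moreover have "(norm (a - (s / norm r) *\<^sub>R r))\<^sup>2 = (norm a)\<^sup>2 - 2 * (s * (r \<bullet> a / norm r)) + s\<^sup>2"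
  proof -
    have "norm ((s / norm r) *\<^sub>R r) = s" using r s by simp
    then show ?thesis
      using dot_norm_neg[of a "(s / norm r) *\<^sub>R r"] by (simp add: inner_commute field_simps)
  qed
  ultimately have "(norm (a - (s / norm r) *\<^sub>R r))\<^sup>2 \<le> 0"
    using \<open>(norm a)\<^sup>2 \<le> s\<^sup>2\<close> by linarith
  then show ?thesis by (simp add: r_def s_def)
qed

section \<open>The Lagrangian dual function\<close>

text \<open>Regrouping by primal variable separates the constant \<open>dual_obj Y a\<close>, the
  cone pair \<open>(v, t)\<close> and the two orthant variables, so the infimum can be studied block
  by block.\<close>

lemma conic_lagrangian_eq:
  "conic_lagrangian Y X l (t, v, bp, bm) a = dual_obj Y a + (t / sqrt (real CARD('n)) - a \<bullet> v / real CARD('n))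
    + (\<Sum>j\<in>UNIV. (l - (\<Sum>i\<in>UNIV. X $ i $ j * a $ i)) * bp $ j
        + (l + (\<Sum>i\<in>UNIV. X $ i $ j * a $ i)) * bm $ j) / real CARD('n)"
  for Y :: "real^'n"
proof -
  let ?n = "real CARD('n)"
  have "(\<Sum>i\<in>UNIV. a $ i / ?n * (Y $ i - row i X \<bullet> bp + row i X \<bullet> bm - v $ i))
      = (a \<bullet> (Y - X *v bp + X *v bm - v)) / ?n"
    unfolding row_inner by (simp add: inner_vec_def sum_divide_distrib)
  also have "\<dots> = dual_obj Y a - a \<bullet> v / ?n + (a \<bullet> (X *v bm) - a \<bullet> (X *v bp)) / ?n"
    by (simp add: dual_obj_eq inner_diff_right inner_add_right inner_commute diff_divide_distrib add_divide_distrib)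
  finally show ?thesis
    unfolding conic_lagrangian_def conic_obj_def prod.case inner_matrix_vector_mult
    by (simp add: algebra_simps sum.distrib sum_subtractf sum_distrib_left add_divide_distrib diff_divide_distrib)
qed

text \<open>At the origin only the constant remains. Elsewhere the dual constraints make every other
  block nonnegative: Cauchy-Schwarz on the cone, signs of coefficients on the orthants.\<close>

lemma conic_dual_function_feasible:
  fixes Y :: "real^'n" and X :: "real^'p^'n"
  assumes feas: "a \<in> dual_feasible X l"
  shows "conic_dual_function Y X l a = ereal (dual_obj Y a)"
proof (rule antisym)
  have "(0, 0, 0, 0) \<in> conic_domain"
    by (simp add: conic_domain_def ice_cream_cone_def nonneg_orthant_def)
  then show "conic_dual_function Y X l a \<le> ereal (dual_obj Y a)"
    unfolding conic_dual_function_def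
    by (rule INF_lower2) (simp add: conic_lagrangian_eq)
  show "ereal (dual_obj Y a) \<le> conic_dual_function Y X l a"
    unfolding conic_dual_function_def
  proof (rule INF_greatest)
    fix z assume "z \<in> (conic_domain :: ('n, 'p) conic_point set)"
    then obtain t v bp bm where z: "z = (t, v, bp, bm)"
      and d: "norm v \<le> t" "\<And>j. 0 \<le> bp $ j" "\<And>j. 0 \<le> bm $ j"
      by (auto simp: conic_domain_def ice_cream_cone_def nonneg_orthant_def)
    have "a \<bullet> v \<le> norm a * norm v" by (rule norm_cauchy_schwarz)
    also have "\<dots> \<le> sqrt (real CARD('n)) * t"
      using feas d by (intro mult_mono) (auto simp: dual_feasible_iff)
    finally have "a \<bullet> v / real CARD('n) \<le> t / sqrt (real CARD('n))"
      by (simp add: divide_sqrt_eq divide_right_mono mult.commute)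
    moreover have "0 \<le> l - (\<Sum>i\<in>UNIV. X $ i $ j * a $ i)"
      "0 \<le> l + (\<Sum>i\<in>UNIV. X $ i $ j * a $ i)" for j
    proof -
      have "\<bar>\<Sum>i\<in>UNIV. X $ i $ j * a $ i\<bar> \<le> l"
        using feas by (simp add: dual_feasible_iff_columns)
      then show "0 \<le> l - (\<Sum>i\<in>UNIV. X $ i $ j * a $ i)"
        "0 \<le> l + (\<Sum>i\<in>UNIV. X $ i $ j * a $ i)" by linarith+
    qed
    then have "0 \<le> (\<Sum>j\<in>UNIV. (l - (\<Sum>i\<in>UNIV. X $ i $ j * a $ i)) * bp $ j
        + (l + (\<Sum>i\<in>UNIV. X $ i $ j * a $ i)) * bm $ j)"
      using d(2,3) by (meson sum_nonneg add_nonneg_nonneg mult_nonneg_nonneg)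
    then have "0 \<le> (\<Sum>j\<in>UNIV. (l - (\<Sum>i\<in>UNIV. X $ i $ j * a $ i)) * bp $ j
        + (l + (\<Sum>i\<in>UNIV. X $ i $ j * a $ i)) * bm $ j) / real CARD('n)"
      by (rule divide_nonneg_nonneg) simp
    ultimately show "ereal (dual_obj Y a) \<le> ereal (conic_lagrangian Y X l z a)"
      by (simp add: z conic_lagrangian_eq)
  qed
qed

text \<open>Along the ray \<open>p\<close> the function is affine with negative slope
  \<open>q\<close>, hence unbounded below.\<close>

lemma INF_ereal_ray_eq_minus_infinity:
  fixes F :: "'a \<Rightarrow> real"
  assumes ray: "\<And>r. r \<ge> 0 \<Longrightarrow> p r \<in> D" "\<And>r. r \<ge> 0 \<Longrightarrow> F (p r) = c + r * q" and "q < 0"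
  shows "(INF z\<in>D. ereal (F z)) = -\<infinity>"
proof (rule ereal_bot)
  fix B
  \<comment> \<open>Chosen so that \<open>c + r * q\<close> is \<open>c\<close> minus the distance
    from \<open>B\<close> to \<open>c\<close>, hence at most \<open>B\<close>.\<close>
  define r where "r = \<bar>B - c\<bar> / - q"
  have r: "r \<ge> 0" "r * q = - \<bar>B - c\<bar>" using \<open>q < 0\<close> by (auto simp: r_def divide_nonneg_neg)
  then have "(INF z\<in>D. ereal (F z)) \<le> ereal (F (p r))"
    by (intro INF_lower ray)
  also have "\<dots> \<le> ereal B" using ray(2)[of r] r by auto
  finally show "(INF z\<in>D. ereal (F z)) \<le> ereal B" .
qed

text \<open>Each violated dual constraint supplies a ray of the domain starting at the origin on
  which the Lagrangian decreases linearly.\<close>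

lemma conic_dual_function_infeasible:
  fixes Y :: "real^'n" and X :: "real^'p^'n"
  assumes infeas: "a \<notin> dual_feasible X l"
  shows "conic_dual_function Y X l a = -\<infinity>"
proof -
  let ?n = "real CARD('n)" and ?x = "\<lambda>j. \<Sum>i\<in>UNIV. X $ i $ j * a $ i"
  have sum_axis: "(\<Sum>k\<in>UNIV. h k * axis j r $ k) = r * h j" for h :: "'p \<Rightarrow> real" and j r
    by (simp add: axis_def if_distrib cong: if_cong)
  have "\<not> norm a \<le> sqrt ?n \<or> (\<exists>j. ?x j > l) \<or> (\<exists>j. - ?x j > l)"
    using infeas by (auto simp: dual_feasible_iff_columns abs_le_iff not_le)
  then consider "norm a > sqrt ?n" | j where "?x j > l" | j where "- ?x j > l"
    by force
  then show ?thesis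
    unfolding conic_dual_function_def
  proof cases
    case 1
    \<comment> \<open>The ray runs along the boundary of the cone in direction \<open>a\<close>,
      where Cauchy-Schwarz is an equality; its slope is the negative quantity derived next.\<close>
    have "norm a * sqrt ?n < norm a * norm a"
      using 1 by (intro mult_strict_left_mono) (auto intro: le_less_trans[rotated])
    then have "norm a / sqrt ?n - a \<bullet> a / ?n < 0"
      unfolding dot_square_norm
      by (simp add: divide_sqrt_eq power2_eq_square divide_strict_right_mono)
    then show "(INF z\<in>conic_domain. ereal (conic_lagrangian Y X l z a)) = -\<infinity>"
      by (rule INF_ereal_ray_eq_minus_infinity[where c = "dual_obj Y a" and p = "\<lambda>r. (r * norm a, r *\<^sub>R a, 0, 0)", rotated 2])
        (auto simp: conic_domain_def ice_cream_cone_def nonneg_orthant_def conic_lagrangian_eq algebra_simps)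
  next
    \<comment> \<open>Here the slope is the negative coefficient of \<open>bp $ j\<close>; in the
      remaining case it is that of \<open>bm $ j\<close>.\<close>
    case 2
    then have "(l - ?x j) / ?n < 0" by (simp add: divide_neg_pos)
    then show "(INF z\<in>conic_domain. ereal (conic_lagrangian Y X l z a)) = -\<infinity>"
      by (rule INF_ereal_ray_eq_minus_infinity[where c = "dual_obj Y a" and p = "\<lambda>r. (0, 0, axis j r, 0)", rotated 2])
        (auto simp: conic_domain_def ice_cream_cone_def nonneg_orthant_def conic_lagrangian_eq sum_axis,
          auto simp: axis_def)
  next
    case 3
    then have "(l + ?x j) / ?n < 0" by (simp add: divide_neg_pos)
    then show "(INF z\<in>conic_domain. ereal (conic_lagrangian Y X l z a)) = -\<infinity>"
      by (rule INF_ereal_ray_eq_minus_infinity[where c = "dual_obj Y a" and p = "\<lambda>r. (0, 0, 0, axis j r)", rotated 2])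
        (auto simp: conic_domain_def ice_cream_cone_def nonneg_orthant_def conic_lagrangian_eq sum_axis,
          auto simp: axis_def)
  qed
qed

section \<open>Equivalence, strong duality and the relation between solutions\<close>

theorem theorem2:
  fixes Y :: "real^'n" and X :: "real^'p^'n" and l :: real
  assumes "l > 0"
  shows
    "\<comment> \<open>the minima and the maximum are attained\<close>
     (\<exists>\<beta>. sqrt_lasso_solution Y X l \<beta>) \<and>
     (\<exists>z. conic_solution Y X l z) \<and>
     (\<exists>a. dual_solution Y X l a) \<and>
     \<comment> \<open>equivalence of the square-root lasso and the conic program\<close>
     sqrt_lasso_value Y X l = conic_value Y X l \<and>
     (\<forall>t v bp bm. conic_solution Y X l (t, v, bp, bm) \<longrightarrow> sqrt_lasso_solution Y X l (bp - bm)) \<and>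
     (\<forall>\<beta>. sqrt_lasso_solution Y X l \<beta> \<longrightarrow>
        (\<exists>t v bp bm. conic_solution Y X l (t, v, bp, bm) \<and> \<beta> = bp - bm)) \<and>
     \<comment> \<open>the third problem is the Lagrangian dual of the conic program, with no duality gap\<close>
     (\<forall>a. conic_dual_function Y X l a =
        (if a \<in> dual_feasible X l then ereal (dual_obj Y a) else -\<infinity>)) \<and>
     conic_value Y X l = dual_value Y X l \<and>
     \<comment> \<open>relation between corresponding solutions\<close>
     (\<forall>\<beta> t v bp bm a.
        sqrt_lasso_solution Y X l \<beta> \<and> Y \<noteq> X *v \<beta> \<and>
        conic_solution Y X l (t, v, bp, bm) \<and> \<beta> = bp - bm \<and>
        dual_solution Y X l a \<longrightarrow>
          \<beta> = bp - bm \<and>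
          (\<forall>i. v $ i = Y $ i - row i X \<bullet> \<beta>) \<and>
          a = (sqrt (real CARD('n)) / norm v) *\<^sub>R v)"
proof (intro conjI allI impI)
  have l: "0 \<le> l" using assms by simp
  show P: "\<exists>\<beta>. sqrt_lasso_solution Y X l \<beta>"
    using assms by (rule sqrt_lasso_solution_exists)
  then show "\<exists>z. conic_solution Y X l z"
    using conic_solution_conic_lift[OF l] by blast
  show "\<exists>a. dual_solution Y X l a"
    using assms by (rule dual_solution_exists)
  show PC: "sqrt_lasso_value Y X l = conic_value Y X l"
    using l by (rule sqrt_lasso_value_eq_conic_value)
  show "conic_value Y X l = dual_value Y X l"
    using sqrt_lasso_value_eq_dual_value[OF assms, of Y X] by (simp add: PC)
  show "sqrt_lasso_solution Y X l (bp - bm)" if "conic_solution Y X l (t, v, bp, bm)" for t v bp bm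
    using l that by (rule sqrt_lasso_solution_diff)
  show "\<exists>t v bp bm. conic_solution Y X l (t, v, bp, bm) \<and> \<beta> = bp - bm"
    if "sqrt_lasso_solution Y X l \<beta>" for \<beta>
    using conic_solution_conic_lift[OF l that] diff_pos_neg_part[of \<beta>, symmetric]
    unfolding conic_lift_def by blast
  show "conic_dual_function Y X l a =
      (if a \<in> dual_feasible X l then ereal (dual_obj Y a) else -\<infinity>)" for a
    by (simp add: conic_dual_function_feasible conic_dual_function_infeasible)
  fix \<beta> t v bp bm a
  assume H: "sqrt_lasso_solution Y X l \<beta> \<and> Y \<noteq> X *v \<beta> \<and>
    conic_solution Y X l (t, v, bp, bm) \<and> \<beta> = bp - bm \<and> dual_solution Y X l a"
  then show "\<beta> = bp - bm" by blast
  have v: "v = Y - X *v \<beta>"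
    using H by (simp add: conic_solution_def is_arg_min_def conic_feasible_iff)
  then show "v $ i = Y $ i - row i X \<bullet> \<beta>" for i
    by (simp add: row_inner)
  show "a = (sqrt (real CARD('n)) / norm v) *\<^sub>R v"
    unfolding v using H by (intro dual_solution_eq[OF assms]) auto
qed

end
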